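(* Consider a partially observed linear causal model with $m\ge 1$ latent variables and parameters $\theta=(F_{\mathbf L\mathbf L},F_{\mathbf L\mathbf X},F_{\mathbf X\mathbf L},F_{\mathbf X\mathbf X},\Omega_{\epsilon_{\mathbf L}},\Omega_{\epsilon_{\mathbf X}})$. Let $\Lambda$ be any invertible diagonal $m\times m$ matrix, and let $\tilde\theta=(\tilde F_{\mathbf L\mathbf L},\tilde F_{\mathbf L\mathbf X},\tilde F_{\mathbf X\mathbf L},\tilde F_{\mathbf X\mathbf X},\tilde\Omega_{\epsilon_{\mathbf L}},\tilde\Omega_{\epsilon_{\mathbf X}})$, where $$\tilde F_{\mathbf L\mathbf L}=\Lambda^{-1}F_{\mathbf L\mathbf L}\Lambda,\quad \tilde F_{\mathbf L\mathbf X}=\Lambda^{-1}F_{\mathbf L\mathbf X},\quad \tilde F_{\mathbf X\mathbf L}=F_{\mathbf X\mathbf L}\Lambda,\quad \tilde F_{\mathbf X\mathbf X}=F_{\mathbf X\mathbf X},\quad \tilde\Omega_{\epsilon_{\mathbf L}}=\Lambda^2\Omega_{\epsilon_{\mathbf L}},\quad \tilde\Omega_{\epsilon_{\mathbf X}}=\Omega_{\epsilon_{\mathbf X}}.$$ Then $\tilde\theta$ and $\theta$ entail the same observations, i.e. $\tilde\Sigma_{\mathbf X}=\Sigma_{\mathbf X}$. Furthermore, $\tilde\Sigma_{\mathbf L}=\Lambda\Sigma_{\mathbf L}\Lambda$.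
   Context: Partially observed linear causal model: Let $\mathcal G$ be a DAG on $m+n$ variables $\mathbf V=\mathbf L\cup\mathbf X$, with $m$ latent variables $\mathbf L=\{L_1,\dots,L_m\}$ and $n$ observed variables $\mathbf X$. Each variable satisfies $V_i=\sum_{V_j\in \mathrm{Pa}_{\mathcal G}(V_i)} f_{j,i}V_j+\epsilon_{V_i}$ with independent Gaussian noise terms; in matrix form $\mathbf V=F^T\mathbf V+\epsilon_{\mathbf V}$, where $F=(f_{j,i})$ and $f_{j,i}\ne 0$ if and only if $V_j$ is a parent of $V_i$ in $\mathcal G$. Write, with latent variables ordered first, $$F=\begin{pmatrix} F_{\mathbf L\mathbf L} & F_{\mathbf L\mathbf X} \\ F_{\mathbf X\mathbf L} & F_{\mathbf X\mathbf X} \end{pmatrix},\qquad \Omega=\begin{pmatrix} \Omega_{\epsilon_{\mathbf L}} & 0 \\ 0 & \Omega_{\epsilon_{\mathbf X}} \end{pmatrix},$$ where $\Omega$ is the diagonal covariance matrix of $\epsilon_{\mathbf V}$. The covariance matrix of $\mathbf V$ entailed by $(F,\Omega)$ is $(I-F)^{-T}\Omega(I-F)^{-1}$; $\Sigma_{\mathbf L}$ and $\Sigma_{\mathbf X}$ denote its principal blocks for $\mathbf L$ and $\mathbf X$. $\tilde\Sigma_{\mathbf L},\tilde\Sigma_{\mathbf X}$ denote the corresponding matrices entailed by $\tilde\theta$. *)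

theory Defs
  imports "Jordan_Normal_Form.Gauss_Jordan_Elimination"
begin

text \<open>
  Variables are indexed by \<open>0, \<dots>, m + n - 1\<close>: the indices below \<open>m\<close> are the latent variables and
  the remaining \<open>n\<close> are the observed ones.  A directed graph is given by its edge set, where
  \<open>(j, i)\<close> is the edge from \<open>V\<^sub>j\<close> to \<open>V\<^sub>i\<close>.
\<close>

definition dag_on :: "nat \<Rightarrow> (nat \<times> nat) set \<Rightarrow> bool" where
  "dag_on k G \<longleftrightarrow> G \<subseteq> {..<k} \<times> {..<k} \<and> acyclic G"

record lin_params =
  F_LL :: "real mat"
  F_LX :: "real mat"
  F_XL :: "real mat"
  F_XX :: "real mat"
  Omega_L :: "real mat"
  Omega_X :: "real mat"

definition F_mat :: "lin_params \<Rightarrow> real mat" where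
  "F_mat \<theta> = four_block_mat (F_LL \<theta>) (F_LX \<theta>) (F_XL \<theta>) (F_XX \<theta>)"

definition Omega_mat :: "nat \<Rightarrow> nat \<Rightarrow> lin_params \<Rightarrow> real mat" where
  "Omega_mat m n \<theta> = four_block_mat (Omega_L \<theta>) (0\<^sub>m m n) (0\<^sub>m n m) (Omega_X \<theta>)"

text \<open>The entries of the diagonal of \<open>\<Omega>\<close> are the variances of the independent Gaussian noise
  terms; a variance of zero (a degenerate Gaussian) is allowed.\<close>

definition model_params :: "nat \<Rightarrow> nat \<Rightarrow> (nat \<times> nat) set \<Rightarrow> lin_params \<Rightarrow> bool" where
  "model_params m n G \<theta> \<longleftrightarrow>
     F_LL \<theta> \<in> carrier_mat m m \<and> F_LX \<theta> \<in> carrier_mat m n \<and>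
     F_XL \<theta> \<in> carrier_mat n m \<and> F_XX \<theta> \<in> carrier_mat n n \<and>
     Omega_L \<theta> \<in> carrier_mat m m \<and> Omega_X \<theta> \<in> carrier_mat n n \<and>
     (\<forall>i<m + n. \<forall>j<m + n. F_mat \<theta> $$ (j, i) \<noteq> 0 \<longleftrightarrow> (j, i) \<in> G) \<and>
     diagonal_mat (Omega_mat m n \<theta>) \<and>
     (\<forall>i<m + n. 0 \<le> Omega_mat m n \<theta> $$ (i, i))"

text \<open>Only meaningful for invertible matrices, since \<^const>\<open>mat_inverse\<close> returns \<^const>\<open>None\<close>
  otherwise.\<close>

definition mat_inv :: "real mat \<Rightarrow> real mat" where
  "mat_inv A = the (mat_inverse A)"

definition covariance :: "nat \<Rightarrow> nat \<Rightarrow> lin_params \<Rightarrow> real mat" where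
  "covariance m n \<theta> =
     transpose_mat (mat_inv (1\<^sub>m (m + n) - F_mat \<theta>)) * Omega_mat m n \<theta> *
     mat_inv (1\<^sub>m (m + n) - F_mat \<theta>)"

definition Sigma_L :: "nat \<Rightarrow> nat \<Rightarrow> lin_params \<Rightarrow> real mat" where
  "Sigma_L m n \<theta> = (case split_block (covariance m n \<theta>) m m of (A, _, _, _) \<Rightarrow> A)"

definition Sigma_X :: "nat \<Rightarrow> nat \<Rightarrow> lin_params \<Rightarrow> real mat" where
  "Sigma_X m n \<theta> = (case split_block (covariance m n \<theta>) m m of (_, _, _, D) \<Rightarrow> D)"

end

theory Submission
  imports Defs "Jordan_Normal_Form.Determinant"
begin

text \<open>
  With \<open>P = diag(\<Lambda>, I)\<close> the new parameters are \<open>F' = P\<^sup>-\<^sup>1 F P\<close> and, as diagonal matrices commute,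
  \<open>\<Omega>' = P \<Omega> P\<close>.  Hence \<open>(I - F')\<^sup>-\<^sup>1 = P\<^sup>-\<^sup>1 (I - F)\<^sup>-\<^sup>1 P\<close>, and \<open>P\<^sup>T = P\<close> makes the entailed
  covariance \<open>P \<Sigma> P\<close>, whose diagonal blocks are \<open>\<Lambda> \<Sigma>\<^sub>L \<Lambda>\<close> and \<open>\<Sigma>\<^sub>X\<close>.  Acyclicity of the graph
  ensures that \<open>I - F\<close> is invertible: a kernel vector vanishes at every variable all of whose
  children it vanishes at.
\<close>

text \<open>A right inverse of a square matrix over a field is two-sided, so \<open>A\<close> is a
  unit of the matrix ring and \<open>mat_inverse\<close> cannot return \<open>None\<close>; this
  makes the \<open>the\<close> in \<open>mat_inv\<close> well-behaved.\<close>

lemma mat_inv_inverse: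
  assumes A: "A \<in> carrier_mat k k" and B: "B \<in> carrier_mat k k" and AB: "A * B = 1\<^sub>m k"
  shows "mat_inv A \<in> carrier_mat k k" "A * mat_inv A = 1\<^sub>m k" "mat_inv A * A = 1\<^sub>m k"
proof -
  have BA: "B * A = 1\<^sub>m k" by (rule mat_mult_left_right_inverse[OF A B AB])
  have "A \<in> Units (ring_mat TYPE(real) k ())"
    using A B AB BA by (auto simp: Units_def ring_mat_def)
  then obtain C where "mat_inverse A = Some C"
    using mat_inverse(1)[OF A] by fastforce
  with mat_inverse(2)[OF A this]
  show "mat_inv A \<in> carrier_mat k k" "A * mat_inv A = 1\<^sub>m k" "mat_inv A * A = 1\<^sub>m k"
    by (auto simp: mat_inv_def)
qed

lemma mat_inv_eqI:
  assumes A: "A \<in> carrier_mat k k" and B: "B \<in> carrier_mat k k" and AB: "A * B = 1\<^sub>m k"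
  shows "mat_inv A = B"
proof -
  note inv = mat_inv_inverse[OF A B AB]
  have "mat_inv A = mat_inv A * (A * B)" using inv AB by simp
  also have "\<dots> = (mat_inv A * A) * B" using inv(1) A B by simp
  also have "\<dots> = B" using inv B by simp
  finally show ?thesis .
qed

lemma invertible_mat_mat_inv:
  assumes A: "A \<in> carrier_mat k k" and "invertible_mat A"
  shows "mat_inv A \<in> carrier_mat k k" "A * mat_inv A = 1\<^sub>m k" "mat_inv A * A = 1\<^sub>m k"
proof -
  obtain B where AB: "A * B = 1\<^sub>m k" and BA: "B * A = 1\<^sub>m (dim_row B)"
    using assms by (auto simp: invertible_mat_def inverts_mat_def)
  \<comment> \<open>\<open>invertible_mat\<close> supplies \<open>B\<close> without a carrier; its
    dimensions are recovered by comparing column counts in the two product equations.\<close>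
  have "dim_col B = k" using arg_cong[OF AB, of dim_col] by simp
  moreover have "dim_row B = k" using arg_cong[OF BA, of dim_col] A by simp
  ultimately have B: "B \<in> carrier_mat k k" by auto
  show "mat_inv A \<in> carrier_mat k k" "A * mat_inv A = 1\<^sub>m k" "mat_inv A * A = 1\<^sub>m k"
    using mat_inv_inverse[OF A B AB] by auto
qed

lemma invertible_one_minus_acyclic:
  assumes F: "F \<in> carrier_mat k k" and dag: "dag_on k G"
    and supp: "\<And>i j. i < k \<Longrightarrow> j < k \<Longrightarrow> F $$ (j, i) \<noteq> 0 \<Longrightarrow> (j, i) \<in> G"
  obtains B :: "real mat" where "B \<in> carrier_mat k k" "(1\<^sub>m k - F) * B = 1\<^sub>m k"
proof -
  have IF: "1\<^sub>m k - F \<in> carrier_mat k k" by (rule minus_carrier_mat[OF F])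
  have "finite G" using dag by (auto simp: dag_on_def intro: finite_subset)
  \<comment> \<open>Well-foundedness of the converse lets the induction start at the sinks: the
    hypothesis for \<open>j\<close> speaks of the children of \<open>j\<close>.\<close>
  then have wf: "wf (G\<inverse>)" using dag by (auto simp: dag_on_def intro: finite_acyclic_wf_converse)
  have "det (1\<^sub>m k - F) \<noteq> 0"
  proof
    assume "det (1\<^sub>m k - F) = 0"
    then obtain v where v: "v \<in> carrier_vec k" "v \<noteq> 0\<^sub>v k" "(1\<^sub>m k - F) *\<^sub>v v = 0\<^sub>v k"
      using det_0_iff_vec_prod_zero_field[OF IF] by auto
    \<comment> \<open>The kernel equation says \<open>v = F v\<close>. Row \<open>j\<close> of
      \<open>F\<close> carries the edges leaving \<open>j\<close>, so \<open>v $ j\<close> is a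
      combination of the values at its children.\<close>
    have eq: "v $ j = (\<Sum>i<k. F $$ (j, i) * v $ i)" if "j < k" for j
    proof -
      have "v - F *\<^sub>v v = 0\<^sub>v k"
        using v minus_mult_distrib_mat_vec[OF one_carrier_mat F v(1)] by simp
      then have "(v - F *\<^sub>v v) $ j = 0" using that by simp
      then have "v $ j = (F *\<^sub>v v) $ j" using that F by simp
      also have "\<dots> = (\<Sum>i<k. F $$ (j, i) * v $ i)"
        using that F v by (auto simp: scalar_prod_def lessThan_atLeast0 intro!: sum.cong)
      finally show ?thesis .
    qed
    have "j < k \<longrightarrow> v $ j = 0" for j
    proof (induction j rule: wf_induct_rule[OF wf])
      case (1 j)
      \<comment> \<open>Either \<open>i\<close> is a child of \<open>j\<close> and
        \<open>v $ i\<close> vanishes by induction, or the coefficient is zero.\<close>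
      have "F $$ (j, i) * v $ i = 0" if "j < k" "i < k" for i
        using 1[of i] supp[of i j] that by auto
      then show ?case using eq[of j] by (auto intro!: sum.neutral)
    qed
    then have "v = 0\<^sub>v k" using v(1) by auto
    with v(2) show False by simp
  qed
  then have "1\<^sub>m k - F \<in> Units (ring_mat TYPE(real) k ())"
    by (rule det_non_zero_imp_unit[OF IF])
  then show ?thesis using that by (auto simp: Units_def ring_mat_def)
qed

lemma transpose_diagonal_mat:
  assumes "A \<in> carrier_mat k k" "diagonal_mat A"
  shows "transpose_mat A = A"
  using assms by (intro eq_matI) (auto simp: diagonal_mat_def, metis)

lemma diagonal_mat_mult_index:
  fixes A B :: "'a :: semiring_0 mat"
  assumes "A \<in> carrier_mat k k" "B \<in> carrier_mat k l" "diagonal_mat A" "i < k" "j < l"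
  shows "(A * B) $$ (i, j) = A $$ (i, i) * B $$ (i, j)"
proof -
  have "(A * B) $$ (i, j) = (\<Sum>r\<in>{0..<k}. A $$ (i, r) * B $$ (r, j))"
    using assms by (simp add: scalar_prod_def)
  also have "\<dots> = (\<Sum>r\<in>{0..<k}. if r = i then A $$ (i, i) * B $$ (i, j) else 0)"
    using assms by (intro sum.cong) (auto simp: diagonal_mat_def)
  also have "\<dots> = A $$ (i, i) * B $$ (i, j)" using assms by simp
  finally show ?thesis .
qed

lemma diagonal_mat_mult_commute:
  fixes A B :: "'a :: comm_semiring_0 mat"
  assumes A: "A \<in> carrier_mat k k" "diagonal_mat A" and B: "B \<in> carrier_mat k k" "diagonal_mat B"
  shows "A * B = B * A"
proof (rule eq_matI)
  fix i j assume "i < dim_row (B * A)" "j < dim_col (B * A)"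
  then have ij: "i < k" "j < k" using A B by auto
  have "A $$ (i, i) * B $$ (i, j) = B $$ (i, i) * A $$ (i, j)"
    using ij A B by (cases "i = j") (auto simp: diagonal_mat_def mult.commute)
  then show "(A * B) $$ (i, j) = (B * A) $$ (i, j)"
    using diagonal_mat_mult_index[OF A(1) B(1) A(2) ij]
      diagonal_mat_mult_index[OF B(1) A(1) B(2) ij] by simp
qed (use A B in auto)

text \<open>Here \<open>Q\<close> is the inverse of \<open>P\<close>. In the product of the two
  conjugates the inner \<open>P * Q\<close> cancels first, then \<open>A * B\<close>, then the outer
  \<open>Q * P\<close>.\<close>

lemma mat_inv_similar:
  assumes c: "A \<in> carrier_mat k k" "B \<in> carrier_mat k k" "P \<in> carrier_mat k k" "Q \<in> carrier_mat k k"
    and AB: "A * B = 1\<^sub>m k" and PQ: "P * Q = 1\<^sub>m k"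
  shows "mat_inv (Q * A * P) = Q * B * P"
proof (rule mat_inv_eqI)
  have QP: "Q * P = 1\<^sub>m k" by (rule mat_mult_left_right_inverse[OF c(3,4) PQ])
  have "Q * A * P * (Q * B * P) = Q * A * (P * Q) * (B * P)"
    using c by (simp add: assoc_mult_mat[of _ k k _ k _ k] mult_carrier_mat[of _ k k _ k])
  also have "\<dots> = Q * (A * B) * P"
    using c by (simp add: PQ assoc_mult_mat[of _ k k _ k _ k] mult_carrier_mat[of _ k k _ k])
  also have "\<dots> = 1\<^sub>m k" using c by (simp add: AB QP)
  finally show "Q * A * P * (Q * B * P) = 1\<^sub>m k" .
qed (use c in auto)

text \<open>The block-free core of the theorem: \<open>F\<close> changes by similarity and
  \<open>W\<close> by congruence, and all inner factors \<open>P\<close> and \<open>Q\<close>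
  cancel, leaving a congruence by \<open>P\<close>.\<close>

lemma covariance_similar:
  assumes c: "F \<in> carrier_mat k k" "W \<in> carrier_mat k k" "B \<in> carrier_mat k k"
      "P \<in> carrier_mat k k" "Q \<in> carrier_mat k k"
    and B: "(1\<^sub>m k - F) * B = 1\<^sub>m k" and PQ: "P * Q = 1\<^sub>m k" and sym: "transpose_mat P = P"
  shows "transpose_mat (mat_inv (1\<^sub>m k - Q * F * P)) * (P * W * P) * mat_inv (1\<^sub>m k - Q * F * P)
    = P * (transpose_mat (mat_inv (1\<^sub>m k - F)) * W * mat_inv (1\<^sub>m k - F)) * P"
proof -
  note simps = assoc_mult_mat[of _ k k _ k _ k] mult_carrier_mat[of _ k k _ k]
  have QP: "Q * P = 1\<^sub>m k" by (rule mat_mult_left_right_inverse[OF c(4,5) PQ])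
  have IF: "1\<^sub>m k - F \<in> carrier_mat k k" by (rule minus_carrier_mat[OF c(1)])
  have inv: "mat_inv (1\<^sub>m k - F) = B" by (rule mat_inv_eqI[OF IF c(3) B])
  \<comment> \<open>Since \<open>Q * P\<close> is the identity, the identity matrix can be pulled
    inside the conjugation.\<close>
  have "1\<^sub>m k - Q * F * P = Q * (1\<^sub>m k - F) * P"
    using c QP by (simp add: mult_minus_distrib_mat[of _ k k _ k]
        minus_mult_distrib_mat[of _ k k _ _ k] simps)
  then have inv': "mat_inv (1\<^sub>m k - Q * F * P) = Q * B * P"
    using mat_inv_similar[OF IF c(3-5) B PQ] by simp
  \<comment> \<open>This is the transpose of \<open>P * Q = 1\<^sub>m k\<close>, using the symmetry
    of \<open>P\<close>.\<close>
  have QtP: "transpose_mat Q * P = 1\<^sub>m k"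
    using transpose_mult[OF c(4,5)] PQ sym by simp
  have "transpose_mat (Q * B * P) = P * transpose_mat B * transpose_mat Q"
    using c sym by (simp add: transpose_mult[of _ k k _ k] simps)
  then have "transpose_mat (Q * B * P) * (P * W * P) * (Q * B * P)
    = P * transpose_mat B * (transpose_mat Q * P) * W * (P * Q) * B * P"
    using c by (simp add: simps)
  also have "\<dots> = P * (transpose_mat B * W * B) * P"
    using c by (simp add: QtP PQ simps)
  finally show ?thesis by (simp add: inv inv')
qed

text \<open>The left factor acts on the first block row and the right factor on the first block
  column, so \<open>D\<close> is untouched. It serves for the coefficient matrix, the noise
  covariance and the entailed covariance alike.\<close>

lemma block_scale_mult:
  assumes "A \<in> carrier_mat m m" "B \<in> carrier_mat m n" "C \<in> carrier_mat n m" "D \<in> carrier_mat n n"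
    and "L \<in> carrier_mat m m" "R \<in> carrier_mat m m"
  shows "four_block_mat L (0\<^sub>m m n) (0\<^sub>m n m) (1\<^sub>m n) * four_block_mat A B C D *
      four_block_mat R (0\<^sub>m m n) (0\<^sub>m n m) (1\<^sub>m n)
    = four_block_mat (L * A * R) (L * B) (C * R) (D :: 'a :: comm_ring_1 mat)"
  using assms
  by (simp add: mult_four_block_mat[of _ m m _ n _ n _ _ m _ n] mult_carrier_mat[of _ m m _ m]
      mult_carrier_mat[of _ m m _ n] mult_carrier_mat[of _ n m _ m])

lemma split_block_four_block_mat:
  assumes "A \<in> carrier_mat m m" "B \<in> carrier_mat m n" "C \<in> carrier_mat n m" "D \<in> carrier_mat n n"
  shows "split_block (four_block_mat A B C D) m m = (A, B, C, D)"
  using assms by (auto simp: split_block_def Let_def intro!: eq_matI)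

theorem theorem1:
  fixes m n :: nat
    and G :: "(nat \<times> nat) set"
    and \<theta> \<theta>' :: lin_params
    and \<Lambda> :: "real mat"
  assumes "1 \<le> m"
    and "dag_on (m + n) G"
    and "model_params m n G \<theta>"
    and "\<Lambda> \<in> carrier_mat m m"
    and "diagonal_mat \<Lambda>"
    and "invertible_mat \<Lambda>"
    and "\<theta>' = \<lparr>F_LL = mat_inv \<Lambda> * F_LL \<theta> * \<Lambda>,
               F_LX = mat_inv \<Lambda> * F_LX \<theta>,
               F_XL = F_XL \<theta> * \<Lambda>,
               F_XX = F_XX \<theta>,
               Omega_L = \<Lambda> ^\<^sub>m 2 * Omega_L \<theta>,
               Omega_X = Omega_X \<theta>\<rparr>"
  shows "Sigma_X m n \<theta>' = Sigma_X m n \<theta> \<and>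
         Sigma_L m n \<theta>' = \<Lambda> * Sigma_L m n \<theta> * \<Lambda>"
proof -
  define P where "P = four_block_mat \<Lambda> (0\<^sub>m m n) (0\<^sub>m n m) (1\<^sub>m n)"
  define Q where "Q = four_block_mat (mat_inv \<Lambda>) (0\<^sub>m m n) (0\<^sub>m n m) (1\<^sub>m n)"
  note L = \<open>\<Lambda> \<in> carrier_mat m m\<close>
  note Li = invertible_mat_mat_inv[OF L \<open>invertible_mat \<Lambda>\<close>]
  have cF: "F_LL \<theta> \<in> carrier_mat m m" "F_LX \<theta> \<in> carrier_mat m n" "F_XL \<theta> \<in> carrier_mat n m"
      "F_XX \<theta> \<in> carrier_mat n n"
    and cO: "Omega_L \<theta> \<in> carrier_mat m m" "Omega_X \<theta> \<in> carrier_mat n n"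
    and diag: "diagonal_mat (Omega_mat m n \<theta>)"
    using assms(3) by (auto simp: model_params_def)
  have P: "P \<in> carrier_mat (m + n) (m + n)" using L by (auto simp: P_def)
  have Q: "Q \<in> carrier_mat (m + n) (m + n)" using Li by (auto simp: Q_def)
  have F: "F_mat \<theta> \<in> carrier_mat (m + n) (m + n)" using cF by (auto simp: F_mat_def)
  have W: "Omega_mat m n \<theta> \<in> carrier_mat (m + n) (m + n)" using cO by (auto simp: Omega_mat_def)
  have PQ: "P * Q = 1\<^sub>m (m + n)"
    using L Li by (simp add: P_def Q_def mult_four_block_mat[of _ m m _ n _ n _ _ m _ n])
  have sym: "transpose_mat P = P"
    using L transpose_diagonal_mat[OF L assms(5)]
    by (simp add: P_def transpose_four_block_mat[of _ m m _ n _ n])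
  have "F_mat \<theta> $$ (j, i) \<noteq> 0 \<Longrightarrow> (j, i) \<in> G" if "i < m + n" "j < m + n" for i j
    using assms(3) that by (auto simp: model_params_def)
  then obtain B where B: "B \<in> carrier_mat (m + n) (m + n)"
    and IFB: "(1\<^sub>m (m + n) - F_mat \<theta>) * B = 1\<^sub>m (m + n)"
    using invertible_one_minus_acyclic[OF F assms(2)] by metis
  have F': "F_mat \<theta>' = Q * F_mat \<theta> * P"
    using block_scale_mult[OF cF Li(1) L] by (simp add: F_mat_def P_def Q_def assms(7))
  \<comment> \<open>The model assumes diagonality of the whole noise matrix; indices below
    \<open>m\<close> address its latent block. Diagonality is what lets \<open>\<Lambda>\<close>
    commute past this block.\<close>
  have "diagonal_mat (Omega_L \<theta>)"
    unfolding diagonal_mat_def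
  proof (intro allI impI)
    fix i j assume "i < dim_row (Omega_L \<theta>)" "j < dim_col (Omega_L \<theta>)" "i \<noteq> j"
    then show "Omega_L \<theta> $$ (i, j) = 0"
      using diag[unfolded diagonal_mat_def, rule_format, of i j] cO by (auto simp: Omega_mat_def)
  qed
  then have "\<Lambda> * Omega_L \<theta> = Omega_L \<theta> * \<Lambda>"
    by (rule diagonal_mat_mult_commute[OF L assms(5) cO(1)])
  moreover have "\<Lambda> ^\<^sub>m 2 * Omega_L \<theta> = \<Lambda> * (\<Lambda> * Omega_L \<theta>)"
    using L cO by (simp add: numeral_2_eq_2)
  ultimately have "\<Lambda> ^\<^sub>m 2 * Omega_L \<theta> = \<Lambda> * Omega_L \<theta> * \<Lambda>"
    using assoc_mult_mat[OF L cO(1) L] by simp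
  then have W': "Omega_mat m n \<theta>' = P * Omega_mat m n \<theta> * P"
    using block_scale_mult[OF cO(1) zero_carrier_mat zero_carrier_mat cO(2) L L] L
    by (simp add: Omega_mat_def P_def assms(7))
  have cov: "covariance m n \<theta>' = P * covariance m n \<theta> * P"
    unfolding covariance_def F' W' by (rule covariance_similar[OF F W B P Q IFB PQ sym])
  \<comment> \<open>Identifying the inverse with \<open>B\<close> fixes the dimensions of the
    covariance, which \<open>split_block\<close> requires.\<close>
  have "mat_inv (1\<^sub>m (m + n) - F_mat \<theta>) = B"
    using F B IFB by (intro mat_inv_eqI) auto
  then have dim: "dim_row (covariance m n \<theta>) = m + n" "dim_col (covariance m n \<theta>) = m + n"
    using B by (auto simp: covariance_def)
  obtain S T U V where split: "split_block (covariance m n \<theta>) m m = (S, T, U, V)"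
    by (metis prod_cases4)
  note S = split_block[OF split dim]
  \<comment> \<open>The observed block \<open>V\<close> reappears unchanged while the latent block
    \<open>S\<close> is scaled on both sides; these are the two claims.\<close>
  have "covariance m n \<theta>' = four_block_mat (\<Lambda> * S * \<Lambda>) (\<Lambda> * T) (U * \<Lambda>) V"
    using block_scale_mult[OF S(1-4) L L] S(5) by (simp add: cov P_def)
  moreover have "\<Lambda> * S * \<Lambda> \<in> carrier_mat m m" "\<Lambda> * T \<in> carrier_mat m n" "U * \<Lambda> \<in> carrier_mat n m"
    using S L by auto
  ultimately have "split_block (covariance m n \<theta>') m m = (\<Lambda> * S * \<Lambda>, \<Lambda> * T, U * \<Lambda>, V)"
    using S(4) by (simp add: split_block_four_block_mat)
  then show ?thesis by (simp add: Sigma_X_def Sigma_L_def split)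
qed

end
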